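(* Let $p$ be an odd prime, let $n$ and $k$ be integers coprime to $p$, and let $\chi$ be a Dirichlet character modulo $p$. Then $$\sum_{m=1}^{p-1}\left|\sum_{a=1}^{p-1} \chi(ma+n\overline{a})\, e\!\left(\frac{ka}{p}\right)\right|^2=\begin{cases} 2p-5 & \text{if } \chi=\chi_0,\\ p\big(p-3-\overline{\chi}(-1)\big) & \text{otherwise}. \end{cases}$$
   Context: For an integer $a$ coprime to $p$, $\overline{a}$ denotes an integer with $a\overline{a}\equiv 1 \pmod p$. $e(y)=e^{2\pi i y}$. Every Dirichlet character mod $p$ takes the value $0$ at multiples of $p$; $\chi_0$ is the principal character ($\chi_0(x)=1$ if $p\nmid x$, $0$ otherwise), and $\overline{\chi}$ is the complex conjugate character. *)

theory Defs
  imports Complex_Main "HOL-Number_Theory.Number_Theory"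
    "HOL-Number_Theory.Modular_Inverse"
begin

text \<open>
  A Dirichlet character modulo \<open>q\<close>, regarded as a function on all integers that vanishes exactly at
  the integers not coprime to \<open>q\<close>; \<open>chi 1 = 1\<close> follows from multiplicativity and \<open>chi 1 \<noteq> 0\<close>.
\<close>
definition dirichlet_character :: "int \<Rightarrow> (int \<Rightarrow> complex) \<Rightarrow> bool" where
  "dirichlet_character q chi \<longleftrightarrow>
     (\<forall>x y. chi (x * y) = chi x * chi y) \<and>
     (\<forall>x y. [x = y] (mod q) \<longrightarrow> chi x = chi y) \<and>
     (\<forall>x. chi x \<noteq> 0 \<longleftrightarrow> coprime x q)"

definition principal_character :: "int \<Rightarrow> int \<Rightarrow> complex" where
  "principal_character q x = (if coprime x q then 1 else 0)"

definition conj_character :: "(int \<Rightarrow> complex) \<Rightarrow> int \<Rightarrow> complex" where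
  "conj_character chi x = cnj (chi x)"

definition additive_e :: "real \<Rightarrow> complex" where
  "additive_e y = exp (2 * of_real pi * \<i> * of_real y)"

lemma dirichlet_character_principal: "dirichlet_character q (principal_character q)"
  unfolding dirichlet_character_def principal_character_def
  by (auto intro: cong_imp_coprime dest: cong_sym)

lemma dirichlet_character_conj:
  "dirichlet_character q chi \<Longrightarrow> dirichlet_character q (conj_character chi)"
  unfolding dirichlet_character_def conj_character_def by auto

end

(*
  Let s be the sum of chi over the residues mod p, so s = p - 1 for the principal character and
  s = 0 otherwise; then both cases of the claim read (p - s) * (p + s - 3 - chi (-1)).
  Expanding the square and factoring chi (m a + n / a) = chi a * chi (m + n / a^2) reduces the sum
  over all m mod p to the correlation of chi with its shift, which is p - 1 if b = a or b = -a and
  s - 1 otherwise; the missing term m = 0 contributes cnj (chi a) * chi b. What remains is a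
  combination of squared Gauss sums, each equal to p - s, and of complete exponential sums.
*)
theory Submission
  imports Defs
begin

text \<open>Reduced mod \<open>p\<close>, \<open>h\<close> is an injective self-map of the finite
  set \<open>A\<close>, hence a permutation, and periodicity of \<open>g\<close> hides the
  reduction. All later substitutions use this with \<open>A\<close> the full or the nonzero
  residues.\<close>

lemma sum_reindex_mod:
  fixes p :: int and g :: "int \<Rightarrow> 'a::comm_monoid_add"
  assumes "A \<subseteq> {0..p-1}"
    and "\<And>x. x \<in> A \<Longrightarrow> h x mod p \<in> A"
    and inj: "\<And>x y. x \<in> A \<Longrightarrow> y \<in> A \<Longrightarrow> [h x = h y] (mod p) \<Longrightarrow> [x = y] (mod p)"
    and per: "\<And>x y. [x = y] (mod p) \<Longrightarrow> g x = g y"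
  shows "(\<Sum>x\<in>A. g (h x)) = (\<Sum>x\<in>A. g x)"
proof -
  have fin: "finite A"
    using assms(1) finite_subset by blast
  have "x = y" if "x \<in> A" "y \<in> A" "h x mod p = h y mod p" for x y
  proof -
    have "[x = y] (mod p)"
      by (rule inj) (use that in \<open>simp_all add: cong_def\<close>)
    moreover have "x \<in> {0..p-1}" "y \<in> {0..p-1}"
      using that assms(1) by auto
    ultimately show ?thesis
      by (simp add: cong_def)
  qed
  then have "inj_on (\<lambda>x. h x mod p) A"
    by (auto simp: inj_on_def)
  moreover have "(\<lambda>x. h x mod p) ` A \<subseteq> A"
    using assms(2) by auto
  ultimately have "bij_betw (\<lambda>x. h x mod p) A A"
    using endo_inj_surj[OF fin] by (simp add: bij_betw_def)
  then have "(\<Sum>x\<in>A. g (h x mod p)) = (\<Sum>x\<in>A. g x)"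
    by (rule sum.reindex_bij_betw)
  moreover have "g (h x mod p) = g (h x)" for x
    by (rule per) (simp add: cong_def)
  ultimately show ?thesis
    by simp
qed

text \<open>\<open>psi\<close> abstracts a \<mapsto> e(ka/p), so that \<open>k\<close> and the
  exponential disappear from the argument. The condition \<open>psi_eq_1\<close> encodes both
  periodicity mod \<open>p\<close> (\<open>psi_cong\<close>) and nontriviality, which is what makes
  complete sums vanish.\<close>

locale character_pair =
  fixes p :: int and chi psi :: "int \<Rightarrow> complex"
  assumes prime_p: "prime p" and dirichlet: "dirichlet_character p chi"
    and psi_add: "psi (x + y) = psi x * psi y"
    and psi_eq_1: "psi x = 1 \<longleftrightarrow> p dvd x"
    and cnj_psi: "cnj (psi x) = psi (- x)"
begin

abbreviation residue_set :: "int set" ("Z") where "Z \<equiv> {0..p-1}"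
abbreviation unit_set :: "int set" ("U") where "U \<equiv> {1..p-1}"
abbreviation inverse_mod ("iv") where "iv \<equiv> modular_inverse p"

definition char_sum :: complex where "char_sum = (\<Sum>x\<in>U. chi x)"

section \<open>Residues and divisibility modulo \<open>p\<close>\<close>

lemma p_gt_1: "p > 1"
  using prime_p by (rule prime_gt_1_int)

lemma Z_eq: "Z = insert 0 U"
  using p_gt_1 by auto

lemma mod_in_Z: "x mod p \<in> Z"
  using p_gt_1 pos_mod_bound[of p x] by simp

lemma mod_in_U: "\<not> p dvd x \<Longrightarrow> x mod p \<in> U"
  using mod_in_Z[of x] by (auto simp: dvd_eq_mod_eq_0 Z_eq)

lemma dvd_imp_eq_0: "p dvd x \<Longrightarrow> \<bar>x\<bar> < p \<Longrightarrow> x = 0"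
  using dvd_imp_le_int[of x p] p_gt_1 by fastforce

lemma U_not_dvd: "x \<in> U \<Longrightarrow> \<not> p dvd x"
  using dvd_imp_eq_0[of x] by auto

lemma coprime_iff: "coprime x p \<longleftrightarrow> \<not> p dvd x"
  using prime_imp_coprime[OF prime_p, of x] coprime_common_divisor[of x p p] prime_p
  by (auto simp: coprime_commute[of x p])

lemma dvd_mult_iff: "p dvd x * y \<longleftrightarrow> p dvd x \<or> p dvd y"
  using prime_p by (rule prime_dvd_mult_iff)

section \<open>Values of the character and modular inverses\<close>

lemma chi_mult: "chi (x * y) = chi x * chi y"
  using dirichlet unfolding dirichlet_character_def by blast

lemma chi_cong: "[x = y] (mod p) \<Longrightarrow> chi x = chi y"
  using dirichlet unfolding dirichlet_character_def by blast

lemma chi_eq_0: "chi x = 0 \<longleftrightarrow> p dvd x"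
  using dirichlet coprime_iff unfolding dirichlet_character_def by blast

lemma chi_1: "chi 1 = 1"
  using chi_mult[of 1 1] chi_eq_0[of 1] p_gt_1 by auto

lemma chi_power: "chi (x ^ j) = chi x ^ j"
  by (induction j) (simp_all add: chi_1 chi_mult)

text \<open>By Euler's theorem a value at a unit is a root of unity, of exponent
  \<open>totient (nat p)\<close>.\<close>

lemma norm_chi: "norm (chi x) = (if p dvd x then 0 else 1)"
proof (cases "p dvd x")
  case False
  define j where "j = totient (nat p)"
  have "j > 0"
    using p_gt_1 by (simp add: j_def)
  have "[x ^ j = 1] (mod p)"
    using residues.euler_theorem[of p x] False p_gt_1
    by (simp add: j_def residues_def coprime_iff)
  then have "chi x ^ j = 1"
    using chi_cong[of "x ^ j" 1] by (simp add: chi_power chi_1)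
  then show ?thesis
    using False \<open>j > 0\<close> power_eq_1_iff[of "chi x" j] by simp
qed (use chi_eq_0 in auto)

lemma chi_mult_cnj: "chi x * cnj (chi x) = (if p dvd x then 0 else 1)"
  unfolding complex_norm_square[symmetric] by (simp add: norm_chi)

lemma cong_iv: "\<not> p dvd x \<Longrightarrow> [x * iv x = 1] (mod p)"
  by (simp add: cong_modular_inverse1 coprime_iff)

lemma iv_not_dvd: "\<not> p dvd x \<Longrightarrow> \<not> p dvd iv x"
  using coprime_modular_inverse[of x p] by (simp add: coprime_iff)

lemma chi_iv:
  assumes "\<not> p dvd x"
  shows "chi (iv x) = cnj (chi x)"
proof -
  have "chi x \<noteq> 0"
    using assms by (simp add: chi_eq_0)
  have "chi x * chi (iv x) = 1"
    using chi_cong[OF cong_iv[OF assms]] by (simp add: chi_mult chi_1)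
  moreover have "chi x * cnj (chi x) = 1"
    using assms by (simp add: chi_mult_cnj)
  ultimately have "chi x * chi (iv x) = chi x * cnj (chi x)"
    by simp
  then show ?thesis
    using \<open>chi x \<noteq> 0\<close> by simp
qed

lemma cong_mult_lcancel: "\<not> p dvd c \<Longrightarrow> [c * x = c * y] (mod p) \<Longrightarrow> [x = y] (mod p)"
  by (simp add: cong_mult_lcancel coprime_iff)

lemma cong_iv_cancel:
  assumes "\<not> p dvd x" "\<not> p dvd y" "[iv x = iv y] (mod p)"
  shows "[x = y] (mod p)"
proof -
  have "[x * (y * iv y) = x * 1] (mod p)" "[y * (x * iv x) = y * 1] (mod p)"
    using assms cong_iv by (blast intro: cong_scalar_left)+
  \<comment> \<open>Multiplying \<open>iv x = iv y\<close> by \<open>x * y\<close> turns its two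
    sides into \<open>y\<close> and \<open>x\<close>.\<close>
  moreover have "[y * (x * iv x) = x * (y * iv y)] (mod p)"
    using cong_scalar_left[OF assms(3), of "x * y"] by (simp add: mult_ac)
  ultimately show ?thesis
    by (simp add: cong_def)
qed

section \<open>Substitutions in sums over residues\<close>

lemma sum_U_mult:
  assumes "\<not> p dvd c" "\<And>x y. [x = y] (mod p) \<Longrightarrow> g x = g y"
  shows "(\<Sum>x\<in>U. g (c * x)) = (\<Sum>x\<in>U. g x)"
proof (rule sum_reindex_mod[of U p])
  show "g x = g y" if "[x = y] (mod p)" for x y
    using that by (rule assms)
  show "c * x mod p \<in> U" if "x \<in> U" for x
    using that assms(1) U_not_dvd by (intro mod_in_U) (auto simp: dvd_mult_iff)
  show "[x = y] (mod p)" if "[c * x = c * y] (mod p)" for x y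
    using assms(1) that by (rule cong_mult_lcancel)
qed auto

lemma sum_U_mult_iv:
  assumes "\<not> p dvd c" "\<And>x y. [x = y] (mod p) \<Longrightarrow> g x = g y"
  shows "(\<Sum>x\<in>U. g (c * iv x)) = (\<Sum>x\<in>U. g x)"
proof (rule sum_reindex_mod[of U p])
  show "g x = g y" if "[x = y] (mod p)" for x y
    using that by (rule assms)
  show "c * iv x mod p \<in> U" if "x \<in> U" for x
    using that assms(1) U_not_dvd iv_not_dvd by (intro mod_in_U) (auto simp: dvd_mult_iff)
  show "[x = y] (mod p)" if "x \<in> U" "y \<in> U" "[c * iv x = c * iv y] (mod p)" for x y
    using cong_iv_cancel[OF _ _ cong_mult_lcancel[OF assms(1) that(3)]] that U_not_dvd by blast
qed auto

lemma sum_Z_add: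
  assumes "\<And>x y. [x = y] (mod p) \<Longrightarrow> g x = g y"
  shows "(\<Sum>x\<in>Z. g (x + c)) = (\<Sum>x\<in>Z. g x)"
proof (rule sum_reindex_mod[of Z p])
  show "(x + c) mod p \<in> Z" for x
    by (rule mod_in_Z)
  show "[x = y] (mod p)" if "[x + c = y + c] (mod p)" for x y
    using that by (simp add: cong_add_rcancel)
  show "g x = g y" if "[x = y] (mod p)" for x y
    using that by (rule assms)
qed simp

lemma sum_Z: "(\<Sum>x\<in>Z. g x) = g 0 + (\<Sum>x\<in>U. g x)"
  unfolding Z_eq by simp

section \<open>Complete sums of the additive and of the multiplicative character\<close>

lemma psi_0: "psi 0 = 1"
  by (simp add: psi_eq_1)

lemma psi_cong:
  assumes "[x = y] (mod p)"
  shows "psi x = psi y"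
proof -
  have "psi (x - y) = 1"
    using assms by (simp add: psi_eq_1 cong_iff_dvd_diff)
  then show ?thesis
    using psi_add[of "x - y" y] by simp
qed

lemma sum_psi: "(\<Sum>x\<in>U. psi (c * x)) = (if p dvd c then of_int p - 1 else -1)"
proof (cases "p dvd c")
  case True
  then have "psi (c * x) = 1" for x
    by (simp add: psi_eq_1)
  then show ?thesis
    using True p_gt_1 by simp
next
  case False
  \<comment> \<open>The shift by 1 multiplies the complete sum by \<open>psi 1\<close>, which is not
    1, so the sum vanishes; dropping the term at 0 leaves -1.\<close>
  have "(\<Sum>x\<in>Z. psi (x + 1)) = (\<Sum>x\<in>Z. psi x)"
    by (rule sum_Z_add) (rule psi_cong)
  then have "(\<Sum>x\<in>Z. psi x) * psi 1 = (\<Sum>x\<in>Z. psi x)"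
    by (simp add: psi_add sum_distrib_right)
  moreover have "psi 1 \<noteq> 1"
    using psi_eq_1 p_gt_1 by simp
  ultimately have "(\<Sum>x\<in>Z. psi x) = 0"
    by simp
  then have "(\<Sum>x\<in>U. psi x) = -1"
    by (simp add: sum_Z psi_0 add_eq_0_iff)
  then show ?thesis
    using False sum_U_mult[of c psi] psi_cong by simp
qed

lemma char_sum_eq:
  "char_sum = (if chi = principal_character p then of_int p - 1 else 0)"
proof (cases "chi = principal_character p")
  case True
  have "char_sum = (\<Sum>x\<in>U. 1)"
    unfolding char_sum_def using True U_not_dvd
    by (intro sum.cong) (auto simp: principal_character_def coprime_iff)
  then show ?thesis
    using True p_gt_1 by simp
next
  case False
  \<comment> \<open>Both characters vanish at the multiples of \<open>p\<close>, so a point where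
    they differ is a unit with \<open>chi c\<close> different from 1. Multiplying the argument by
    \<open>c\<close> permutes the units and scales the sum by \<open>chi c\<close>.\<close>
  then obtain c where c: "chi c \<noteq> principal_character p c"
    by blast
  then have "\<not> p dvd c" "chi c \<noteq> 1"
    using chi_eq_0 by (auto simp: principal_character_def coprime_iff split: if_splits)
  moreover have "(\<Sum>x\<in>U. chi (c * x)) = char_sum"
    unfolding char_sum_def by (rule sum_U_mult) (use \<open>\<not> p dvd c\<close> chi_cong in auto)
  then have "chi c * char_sum = char_sum"
    by (simp add: char_sum_def chi_mult sum_distrib_left)
  ultimately show ?thesis
    using False by simp
qed

section \<open>Correlation of the character with its shifts\<close>

lemma sum_chi_chi_cnj:
  "(\<Sum>x\<in>Z. chi (x + u) * cnj (chi (x + v))) =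
     (if [u = v] (mod p) then of_int p - 1 else char_sum - 1)"
proof -
  have per: "chi (x + w) * cnj (chi x) = chi (y + w) * cnj (chi y)" if "[x = y] (mod p)" for x y w
    using chi_cong[OF that] chi_cong[OF cong_add[OF that cong_refl]] by simp
  have "(\<Sum>x\<in>Z. chi (x + u) * cnj (chi (x + v)))
      = (\<Sum>x\<in>Z. chi ((x + v) + (u - v)) * cnj (chi (x + v)))"
    by simp
  also have "\<dots> = (\<Sum>x\<in>Z. chi (x + (u - v)) * cnj (chi x))"
    by (rule sum_Z_add) (rule per)
  also have "\<dots> = (\<Sum>x\<in>U. chi (x + (u - v)) * cnj (chi x))"
    by (simp add: sum_Z chi_eq_0)
  \<comment> \<open>On units, conjugation is evaluation at the inverse, so the product collapses to
    one character value, at 1 + (u - v)/x.\<close>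
  also have "\<dots> = (\<Sum>x\<in>U. chi ((u - v) * iv x + 1))"
  proof (rule sum.cong)
    fix x assume "x \<in> U"
    then have x: "\<not> p dvd x"
      by (rule U_not_dvd)
    have "[(x + (u - v)) * iv x = (u - v) * iv x + 1] (mod p)"
      using cong_add[OF cong_refl cong_iv[OF x], of "(u - v) * iv x"] by (simp add: algebra_simps)
    from chi_cong[OF this] show "chi (x + (u - v)) * cnj (chi x) = chi ((u - v) * iv x + 1)"
      using x by (simp add: chi_mult chi_iv)
  qed simp
  also have "\<dots> = (if [u = v] (mod p) then of_int p - 1 else char_sum - 1)"
  proof (cases "[u = v] (mod p)")
    case True
    then have "chi ((u - v) * t + 1) = 1" for t
      using chi_cong[of "(u - v) * t + 1" 1] by (simp add: chi_1 cong_iff_dvd_diff)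
    then show ?thesis
      using True p_gt_1 by simp
  next
    case False
    \<comment> \<open>Here \<open>u - v\<close> is a unit, so (u - v)/x runs through all units. The
      resulting sum of \<open>chi (x + 1)\<close> is a complete character sum without its term
      \<open>chi 1 = 1\<close> at x = 0.\<close>
    then have "(\<Sum>x\<in>U. chi ((u - v) * iv x + 1)) = (\<Sum>x\<in>U. chi (x + 1))"
      by (intro sum_U_mult_iv[where g = "\<lambda>t. chi (t + 1)"])
        (auto intro!: chi_cong cong_add simp: cong_iff_dvd_diff)
    moreover have "(\<Sum>x\<in>Z. chi (x + 1)) = (\<Sum>x\<in>Z. chi x)"
      by (rule sum_Z_add) (rule chi_cong)
    ultimately show ?thesis
      using False by (simp add: sum_Z chi_1 chi_eq_0 char_sum_def algebra_simps)
  qed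
  finally show ?thesis .
qed

section \<open>Squared absolute values of Gauss sums\<close>

lemma gauss_sum_norm:
  assumes "\<not> p dvd c"
  shows "(\<Sum>a\<in>U. \<Sum>b\<in>U. psi (c * (a - b)) * (chi a * cnj (chi b))) = of_int p - char_sum"
proof -
  have "(\<Sum>a\<in>U. \<Sum>b\<in>U. psi (c * (a - b)) * (chi a * cnj (chi b)))
      = (\<Sum>b\<in>U. \<Sum>a\<in>U. psi (c * (a - b)) * (chi a * cnj (chi b)))"
    by (rule sum.swap)
  \<comment> \<open>The substitution a = bt removes \<open>b\<close> from the character part, since
    \<open>chi b * cnj (chi b) = 1\<close>; the sum over \<open>b\<close> is then purely
    additive.\<close>
  also have "\<dots> = (\<Sum>b\<in>U. \<Sum>t\<in>U. psi (c * (b * t - b)) * (chi (b * t) * cnj (chi b)))"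
  proof (rule sum.cong)
    fix b assume "b \<in> U"
    have "psi (c * (x - b)) * (chi x * cnj (chi b)) = psi (c * (y - b)) * (chi y * cnj (chi b))"
      if "[x = y] (mod p)" for x y
    proof -
      have "[c * (x - b) = c * (y - b)] (mod p)"
        by (intro cong_mult cong_diff cong_refl that)
      then show ?thesis
        using chi_cong[OF that] psi_cong by metis
    qed
    then show "(\<Sum>a\<in>U. psi (c * (a - b)) * (chi a * cnj (chi b)))
        = (\<Sum>t\<in>U. psi (c * (b * t - b)) * (chi (b * t) * cnj (chi b)))"
      by (intro sum_U_mult[where g = "\<lambda>x. psi (c * (x - b)) * (chi x * cnj (chi b))", symmetric]
          U_not_dvd \<open>b \<in> U\<close>)
  qed simp
  also have "\<dots> = (\<Sum>b\<in>U. \<Sum>t\<in>U. chi t * psi (c * (t - 1) * b))"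
  proof (intro sum.cong refl)
    fix b t assume "b \<in> U"
    have "psi (c * (b * t - b)) * (chi (b * t) * cnj (chi b))
        = (chi b * cnj (chi b)) * (chi t * psi (c * (t - 1) * b))"
      by (simp add: chi_mult algebra_simps)
    then show "psi (c * (b * t - b)) * (chi (b * t) * cnj (chi b)) = chi t * psi (c * (t - 1) * b)"
      using U_not_dvd[OF \<open>b \<in> U\<close>] by (simp add: chi_mult_cnj)
  qed
  also have "\<dots> = (\<Sum>t\<in>U. chi t * (\<Sum>b\<in>U. psi (c * (t - 1) * b)))"
    by (subst sum.swap) (simp add: sum_distrib_left)
  \<comment> \<open>The inner sum is p - 1 at t = 1 and -1 elsewhere; as \<open>chi 1 = 1\<close>,
    both cases are an indicator term minus \<open>chi t\<close>.\<close>
  also have "\<dots> = (\<Sum>t\<in>U. (if t = 1 then of_int p else 0) - chi t)"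
  proof (intro sum.cong refl)
    fix t assume "t \<in> U"
    then have "p dvd c * (t - 1) \<longleftrightarrow> t = 1"
      using dvd_imp_eq_0[of "t - 1"] assms by (auto simp: dvd_mult_iff)
    then show "chi t * (\<Sum>b\<in>U. psi (c * (t - 1) * b)) = (if t = 1 then of_int p else 0) - chi t"
      unfolding sum_psi by (simp add: chi_1)
  qed
  also have "\<dots> = of_int p - char_sum"
    using p_gt_1 by (simp add: sum_subtractf char_sum_def)
  finally show ?thesis .
qed

text \<open>Exchanging \<open>a\<close> and \<open>b\<close> moves the conjugation back to the other
  factor and reverses the sign in \<open>psi\<close>: this is the case c = -1 of
  \<open>gauss_sum_norm\<close>.\<close>

lemma gauss_sum_norm_cnj:
  "(\<Sum>a\<in>U. \<Sum>b\<in>U. psi (a - b) * (cnj (chi a) * chi b)) = of_int p - char_sum"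
proof -
  have "(\<Sum>a\<in>U. \<Sum>b\<in>U. psi (a - b) * (cnj (chi a) * chi b))
      = (\<Sum>b\<in>U. \<Sum>a\<in>U. psi (-1 * (b - a)) * (chi b * cnj (chi a)))"
    by (subst sum.swap) (simp add: mult.commute)
  also have "\<dots> = of_int p - char_sum"
    by (rule gauss_sum_norm) (use p_gt_1 in simp)
  finally show ?thesis .
qed

section \<open>The sum over \<open>m\<close> for fixed \<open>a\<close> and \<open>b\<close>\<close>

lemma cong_iv_square_iff:
  assumes "\<not> p dvd n" "a \<in> U" "b \<in> U"
  shows "[n * iv a * iv a = n * iv b * iv b] (mod p) \<longleftrightarrow> b = a \<or> b = p - a"
proof -
  have a: "\<not> p dvd a" and b: "\<not> p dvd b"
    using assms U_not_dvd by blast+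
  define d where "d = n * iv a * iv a - n * iv b * iv b"
  \<comment> \<open>Clearing denominators with the unit a^2 b^2 turns n/a^2 - n/b^2 into n(b - a)(b
    + a).\<close>
  have "[n * (a * iv a) * (a * iv a) * (b * b) = n * 1 * 1 * (b * b)] (mod p)"
    by (intro cong_mult cong_refl cong_iv a)
  moreover have "[n * (b * iv b) * (b * iv b) * (a * a) = n * 1 * 1 * (a * a)] (mod p)"
    by (intro cong_mult cong_refl cong_iv b)
  ultimately have "[n * (a * iv a) * (a * iv a) * (b * b) - n * (b * iv b) * (b * iv b) * (a * a)
      = n * 1 * 1 * (b * b) - n * 1 * 1 * (a * a)] (mod p)"
    by (rule cong_diff)
  then have "[a * a * (b * b) * d = n * (b - a) * (b + a)] (mod p)"
    by (simp add: d_def algebra_simps)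
  then have "p dvd a * a * (b * b) * d \<longleftrightarrow> p dvd n * (b - a) * (b + a)"
    by (rule cong_dvd_iff)
  then have "p dvd d \<longleftrightarrow> p dvd b - a \<or> p dvd b + a"
    using assms(1) a b by (simp add: dvd_mult_iff)
  moreover have "p dvd b - a \<longleftrightarrow> b = a"
    using assms(2,3) dvd_imp_eq_0[of "b - a"] by auto
  moreover have "p dvd b + a \<longleftrightarrow> b = p - a"
  proof
    assume "p dvd b + a"
    \<comment> \<open>The sum b + a may exceed \<open>p\<close>, whereas b + a - p is less than
      \<open>p\<close> in absolute value, so divisibility forces it to be 0.\<close>
    then have "p dvd b + a - p"
      by simp
    then have "b + a - p = 0"
      by (rule dvd_imp_eq_0) (use assms(2,3) in auto)
    then show "b = p - a"
      by simp
  qed simp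
  ultimately show ?thesis
    by (simp add: d_def cong_iff_dvd_diff)
qed

text \<open>The case distinction is written as a generic term plus two indicator corrections, so
  that the later double sum over \<open>a\<close> and \<open>b\<close> splits into four separate
  sums.\<close>

lemma sum_chi_twisted:
  assumes "\<not> p dvd n" "odd p" "a \<in> U" "b \<in> U"
  shows "(\<Sum>m\<in>U. chi (m * a + n * iv a) * cnj (chi (m * b + n * iv b))) =
    (char_sum - 1) * (chi a * cnj (chi b))
    + (of_int p - char_sum) * (if b = a then 1 else 0)
    + (of_int p - char_sum) * (if b = p - a then chi (-1) else 0)
    - cnj (chi a) * chi b"
proof -
  have a: "\<not> p dvd a" and b: "\<not> p dvd b"
    using assms U_not_dvd by blast+
  have shift: "chi (m * c + n * iv c) = chi c * chi (m + n * iv c * iv c)" if "\<not> p dvd c" for m c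
  proof -
    have "[m * c + n * iv c * 1 = m * c + n * iv c * (c * iv c)] (mod p)"
      by (intro cong_add cong_mult cong_refl cong_sym[OF cong_iv[OF that]])
    then show ?thesis
      unfolding chi_mult[symmetric] by (intro chi_cong) (simp add: algebra_simps)
  qed
  have "(\<Sum>m\<in>Z. chi (m * a + n * iv a) * cnj (chi (m * b + n * iv b)))
      = chi a * cnj (chi b)
        * (\<Sum>m\<in>Z. chi (m + n * iv a * iv a) * cnj (chi (m + n * iv b * iv b)))"
    by (simp add: shift a b sum_distrib_left mult_ac)
  also have "\<dots> = chi a * cnj (chi b)
        * (if b = a \<or> b = p - a then of_int p - 1 else char_sum - 1)"
    unfolding sum_chi_chi_cnj cong_iv_square_iff[OF assms(1,3,4)] ..
  \<comment> \<open>In the two exceptional cases the correlation exceeds its generic value by (p -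
    1) - (s - 1) = p - s, where s is \<open>char_sum\<close>. The prefactor is 1 at b = a and
    \<open>chi (-1)\<close> at b = p - a, and oddness of \<open>p\<close> keeps these cases
    apart.\<close>
  also have "\<dots> = (char_sum - 1) * (chi a * cnj (chi b))
    + (of_int p - char_sum) * (if b = a then 1 else 0)
    + (of_int p - char_sum) * (if b = p - a then chi (-1) else 0)"
  proof -
    have "a \<noteq> p - a"
      using assms(2) by presburger
    moreover have "chi a * cnj (chi a) = 1"
      using a by (simp add: chi_mult_cnj)
    moreover have "chi a * cnj (chi (p - a)) = chi (-1)"
    proof -
      have "[a = (-1) * (p - a)] (mod p)"
        by (simp add: cong_iff_dvd_diff)
      then have "chi a = chi (-1) * chi (p - a)"
        unfolding chi_mult[symmetric] by (rule chi_cong)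
      moreover have "\<not> p dvd p - a"
        using a by (simp add: dvd_diff_right_iff)
      ultimately show ?thesis
        using chi_mult_cnj[of "p - a"] by (simp add: mult.assoc)
    qed
    ultimately show ?thesis
      by (auto simp: algebra_simps)
  qed
  finally have "(\<Sum>m\<in>Z. chi (m * a + n * iv a) * cnj (chi (m * b + n * iv b))) = \<dots>" .
  \<comment> \<open>The term at m = 0, to be removed from the sum over all residues:
    \<open>chi n\<close> cancels against its conjugate, and the inverses conjugate the remaining
    values.\<close>
  moreover have "chi (n * iv a) * cnj (chi (n * iv b)) = cnj (chi a) * chi b"
  proof -
    have "chi (n * iv a) * cnj (chi (n * iv b)) = (chi n * cnj (chi n)) * (cnj (chi a) * chi b)"
      by (simp add: chi_mult chi_iv a b mult_ac)
    then show ?thesis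
      using assms(1) by (simp add: chi_mult_cnj)
  qed
  ultimately show ?thesis
    by (simp add: sum_Z algebra_simps)
qed

section \<open>The second moment for both kinds of character at once\<close>

lemma second_moment:
  assumes "\<not> p dvd n" "odd p"
  shows "complex_of_real (\<Sum>m\<in>U. (cmod (\<Sum>a\<in>U. chi (m * a + n * iv a) * psi a))\<^sup>2)
    = (of_int p - char_sum) * (of_int p + char_sum - 3 - chi (-1))"
proof -
  define f where "f m a = chi (m * a + n * iv a)" for m a
  have "complex_of_real (\<Sum>m\<in>U. (cmod (\<Sum>a\<in>U. f m a * psi a))\<^sup>2)
      = (\<Sum>m\<in>U. \<Sum>a\<in>U. \<Sum>b\<in>U. psi (a - b) * (f m a * cnj (f m b)))"
    unfolding of_real_sum complex_norm_square
    by (simp add: sum_product cnj_psi psi_add[of _ "- _", simplified] mult_ac)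
  \<comment> \<open>The exponential factor is free of \<open>m\<close>, so the sum over
    \<open>m\<close> can be moved innermost and evaluated first.\<close>
  also have "\<dots> = (\<Sum>a\<in>U. \<Sum>b\<in>U. psi (a - b) * (\<Sum>m\<in>U. f m a * cnj (f m b)))"
    unfolding sum_distrib_left by (subst sum.swap) (intro sum.cong refl sum.swap)
  also have "\<dots> = (\<Sum>a\<in>U. \<Sum>b\<in>U.
      (char_sum - 1) * (psi (a - b) * (chi a * cnj (chi b)))
      + (of_int p - char_sum) * (if b = a then psi (a - b) else 0)
      + (of_int p - char_sum) * (if b = p - a then psi (a - b) * chi (-1) else 0)
      - psi (a - b) * (cnj (chi a) * chi b))"
  proof (intro sum.cong refl)
    fix a b assume "a \<in> U" "b \<in> U"
    show "psi (a - b) * (\<Sum>m\<in>U. f m a * cnj (f m b)) =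
        (char_sum - 1) * (psi (a - b) * (chi a * cnj (chi b)))
        + (of_int p - char_sum) * (if b = a then psi (a - b) else 0)
        + (of_int p - char_sum) * (if b = p - a then psi (a - b) * chi (-1) else 0)
        - psi (a - b) * (cnj (chi a) * chi b)"
      unfolding f_def sum_chi_twisted[OF assms \<open>a \<in> U\<close> \<open>b \<in> U\<close>]
      by (simp add: algebra_simps)
  qed
  also have "\<dots> = (char_sum - 1) * (\<Sum>a\<in>U. \<Sum>b\<in>U. psi (a - b) * (chi a * cnj (chi b)))
      + (of_int p - char_sum) * (\<Sum>a\<in>U. \<Sum>b\<in>U. if b = a then psi (a - b) else 0)
      + (of_int p - char_sum) * (\<Sum>a\<in>U. \<Sum>b\<in>U. if b = p - a then psi (a - b) * chi (-1) else 0)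
      - (\<Sum>a\<in>U. \<Sum>b\<in>U. psi (a - b) * (cnj (chi a) * chi b))"
    by (simp only: sum.distrib sum_subtractf sum_distrib_left)
  also have "(\<Sum>a\<in>U. \<Sum>b\<in>U. if b = a then psi (a - b) else 0) = of_int p - 1"
    using p_gt_1 by (simp add: psi_0)
  also have "(\<Sum>a\<in>U. \<Sum>b\<in>U. if b = p - a then psi (a - b) * chi (-1) else 0)
      = (\<Sum>a\<in>U. psi (2 * a) * chi (-1))"
  proof (intro sum.cong refl)
    fix a assume "a \<in> U"
    then have "(\<Sum>b\<in>U. if b = p - a then psi (a - b) * chi (-1) else 0) = psi (a - (p - a)) * chi (-1)"
      by simp
    also have "psi (a - (p - a)) = psi (2 * a)"
      by (rule psi_cong) (simp add: cong_iff_dvd_diff)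
    finally show "(\<Sum>b\<in>U. if b = p - a then psi (a - b) * chi (-1) else 0) = psi (2 * a) * chi (-1)" .
  qed
  also have "\<dots> = - chi (-1)"
  proof -
    \<comment> \<open>Since 2 is a unit mod \<open>p\<close>, the values 2a run through all nonzero
      residues and the additive sum is -1.\<close>
    have "\<not> p dvd 2"
      using assms(2) p_gt_1 zdvd_imp_le[of p 2] by (cases "p = 2") auto
    then show ?thesis
      by (simp add: sum_psi flip: sum_distrib_right)
  qed
  also note gauss_sum_norm_cnj
  also have "(\<Sum>a\<in>U. \<Sum>b\<in>U. psi (a - b) * (chi a * cnj (chi b))) = of_int p - char_sum"
    using gauss_sum_norm[of 1] p_gt_1 by simp
  \<comment> \<open>With s for \<open>char_sum\<close>, all four contributions contain p - s; the
    cofactors s - 1, p - 1, -\<open>chi (-1)\<close> and -1 add up to p + s - 3 -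
    \<open>chi (-1)\<close>.\<close>
  finally show ?thesis
    unfolding f_def by (simp add: algebra_simps)
qed

end

section \<open>The concrete exponential and the two cases of the theorem\<close>

lemma additive_e_add: "additive_e (x + y) = additive_e x * additive_e y"
  unfolding additive_e_def by (simp add: distrib_left exp_add)

lemma additive_e_eq_cis: "additive_e x = cis (2 * pi * x)"
  by (simp add: additive_e_def cis_conv_exp mult_ac)

lemma additive_e_eq_1_iff: "additive_e x = 1 \<longleftrightarrow> x \<in> \<int>"
proof
  assume "additive_e x = 1"
  then have "cos (2 * pi * x) = 1"
    unfolding additive_e_eq_cis by (metis cis.sel(1) one_complex.sel(1))
  then obtain j :: int where "2 * pi * x = of_int j * 2 * pi"
    using cos_one_2pi_int by blast
  then have "x = of_int j"
    by simp
  then show "x \<in> \<int>"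
    by simp
qed (simp add: additive_e_eq_cis)

lemma cnj_additive_e: "cnj (additive_e x) = additive_e (- x)"
  by (simp add: additive_e_eq_cis cis_cnj)

theorem theorem2p1:
  fixes p n k :: int and chi :: "int \<Rightarrow> complex"
  assumes "prime p" and "odd p"
    and "coprime n p" and "coprime k p"
    and "dirichlet_character p chi"
  shows "complex_of_real
           (\<Sum>m=1..p-1. (cmod (\<Sum>a=1..p-1. chi (m * a + n * modular_inverse p a)
                                 * additive_e (of_int (k * a) / of_int p)))\<^sup>2)
         = (if chi = principal_character p
            then 2 * of_int p - 5
            else of_int p * (of_int p - 3 - conj_character chi (-1)))"
proof -
  define psi where "psi a = additive_e (of_int (k * a) / of_int p)" for a
  have p: "p > 1"
    using assms(1) by (rule prime_gt_1_int)
  interpret character_pair p chi psi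
  proof
    show "psi (x + y) = psi x * psi y" for x y
      by (simp add: psi_def distrib_left add_divide_distrib additive_e_add)
    show "psi x = 1 \<longleftrightarrow> p dvd x" for x
    proof -
      \<comment> \<open>The value is 1 exactly when kx/p is an integer; coprimality of
        \<open>k\<close> and \<open>p\<close> then removes \<open>k\<close>.\<close>
      have "psi x = 1 \<longleftrightarrow> p dvd k * x"
        using p of_int_div_of_int_in_Ints_iff[of "k * x" p, where ?'a = real]
        unfolding psi_def additive_e_eq_1_iff by auto
      also have "\<dots> \<longleftrightarrow> p dvd x"
        using assms(4) by (simp add: coprime_dvd_mult_right_iff coprime_commute)
      finally show ?thesis .
    qed
    show "cnj (psi x) = psi (- x)" for x
      by (simp add: psi_def cnj_additive_e)
  qed fact+
  have "\<not> p dvd n"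
    using assms(3) coprime_iff by blast
  note eq = second_moment[OF this assms(2), unfolded psi_def]
  \<comment> \<open>In the principal case s = p - 1, so the product is 1 * (2p - 4 - 1).\<close>
  have sgn: "chi (-1) = 1" if "chi = principal_character p"
    using that by (simp add: principal_character_def)
  \<comment> \<open>The value at -1 squares to 1, so it is real; this reconciles
    \<open>chi (-1)\<close> with the conjugate in the claim.\<close>
  have "chi (-1) * chi (-1) = 1"
    using chi_mult[of "-1" "-1"] chi_1 by simp
  then have "chi (-1) = 1 \<or> chi (-1) = -1"
    by (simp add: square_eq_1_iff)
  then have "cnj (chi (-1)) = chi (-1)"
    by auto
  then show ?thesis
    unfolding eq using sgn by (simp add: char_sum_eq conj_character_def algebra_simps)
qed

end
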